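(* Let $\mathbf{u},\mathbf{y}\in\mathbb{R}^N$, $\lambda>0$, $\epsilon>0$ and a positive integer $l_{\max}$ be given, and run the greedy algorithm described in the context. Suppose that it terminates without reaching the maximum number of iterations, i.e. it exits through the "break" step with some $l<l_{\max}$, with output the finite set $\hat K_d^l=\{k_1,\dots,k_{p_0+l}\}\subset\hat K$ and the corresponding minimizer $\Gamma^\star(\hat K_d^l)=\{\gamma_i^\star(\hat K_d^l)\}_{i=1}^{p_0+l}$. Define $\hat\Gamma^\star=\{\gamma_k^\star\}_{k\in\hat K}$ by $$\gamma_k^\star=\begin{cases}\gamma_i^\star(\hat K_d^l), & k=k_i\in\hat K_d^l,\\ \mathbf{0}, & k\in\hat K\setminus\hat K_d^l,\end{cases}$$ and let $R=\mathbf{y}-\sum_{k\in\hat K}\zeta_k\gamma_k^\star$ (a sum with finitely many nonzero terms). Then $\hat\Gamma^\star$ satisfies the following approximate optimality conditions for every $k\in\hat K$: $$\begin{cases}\lVert \zeta_k^\top R\rVert_2<\lambda+\epsilon, & \text{if } \lVert\gamma_k^\star\rVert_2=0,\\[2pt] \zeta_k^\top R-\lambda\,\gamma_k^\star/\lVert\gamma_k^\star\rVert_2=0, & \text{if } \lVert\gamma_k^\star\rVert_2>0.\end{cases}$$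
   Context: **Data and atoms.** $\mathbf{u}=[u(1)\ \dots\ u(N)]^\top\in\mathbb{R}^N$ and $\mathbf{y}=[y(1)\ \dots\ y(N)]^\top\in\mathbb{R}^N$ are given input and output data, and $\lambda>0$ is a regularization parameter. Let $$\hat K=\{\alpha\exp(j\beta)\mid \alpha\in[0,1),\ \beta\in[0,\pi]\}\subset\mathbb{C}$$ be the upper half of the open unit disk, with $j$ the imaginary unit. For $k\in\hat K$, the atom is the transfer function $A_k(q)=\dfrac{1-|k|^2}{q-k}$, where $q$ is the shift operator, and $\phi_k\in\mathbb{C}^N$ is the length-$N$ output response of $A_k(q)$ to the input $\mathbf{u}$ from zero initial conditions, i.e. $\phi_k(t)=(1-|k|^2)\sum_{s=1}^{t-1}k^{\,t-1-s}u(s)$ for $t=1,\dots,N$ (with $k^0=1$). Define $$\zeta_k=\begin{bmatrix}2\,\Re(\phi_k) & -2\,\Im(\phi_k)\end{bmatrix}\in\mathbb{R}^{N\times 2}.$$ **Infinite-dimensional group lasso problem.** Over families $\Gamma=\{\gamma_k\}_{k\in\hat K}$ with $\gamma_k\in\mathbb{R}^2$, minimize $$\Big\lVert \mathbf{y}-\sum_{k\in\hat K}\zeta_k\gamma_k\Big\rVert_2^2+2\lambda\sum_{k\in\hat K}\lVert\gamma_k\rVert_2 .$$ **Discretized problem.** For a finite set $\hat K_d=\{k_1,\dots,k_p\}\subset\hat K$ of $p$ elements, $\Gamma^\star(\hat K_d)=\{\gamma_i^\star(\hat K_d)\}_{i=1}^p$ denotes a minimizer over $(\gamma_1,\dots,\gamma_p)\in(\mathbb{R}^2)^p$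 of $$\Big\lVert \mathbf{y}-\sum_{i=1}^p\zeta_{k_i}\gamma_i\Big\rVert_2^2+2\lambda\sum_{i=1}^p\lVert\gamma_i\rVert_2,$$ and $R(\hat K_d)=\mathbf{y}-\sum_{i=1}^p\zeta_{k_i}\gamma_i^\star(\hat K_d)$ denotes the corresponding residual. **Greedy algorithm.** Input: $(\mathbf{u},\mathbf{y})$, $\epsilon>0$, $l_{\max}$. 1. Choose an initial finite set $\hat K_d^0=\{k_1,\dots,k_{p_0}\}\subset\hat K$, compute $\Gamma^\star(\hat K_d^0)$, and set $l\leftarrow 0$. 2. Compute a candidate $k^+\in\operatorname{argmax}_{k\in\hat K}\lVert\zeta_k^\top R(\hat K_d^l)\rVert_2$. 3. If $\lVert\zeta_{k^+}^\top R(\hat K_d^l)\rVert_2\ge\lambda+\epsilon$, set $k_{p_0+l+1}\leftarrow k^+$ and $\hat K_d^{l+1}\leftarrow\hat K_d^l\cup\{k_{p_0+l+1}\}$, and compute $\Gamma^\star(\hat K_d^{l+1})$. Otherwise, break (go to step 5). 4. Set $l\leftarrow l+1$. If $l\ge l_{\max}$, go to step 5; otherwise return to step 2. 5. Output $\hat K_d^l$ and $\Gamma^\star(\hat K_d^l)$. *)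

theory Defs
  imports "HOL-Analysis.Analysis"
begin

text \<open>
  Signals of length \<open>N\<close> are vectors \<open>real ^ 'n\<close> over a finite linearly ordered index type with
  \<open>N = CARD('n)\<close>.  The instant \<open>t :: 'n\<close> is the sampling time \<open>time_of t\<close>, its rank in the order,
  so that the instants enumerate \<open>1, \<dots>, N\<close> in order.
\<close>

definition time_of :: "'n::{finite,linorder} \<Rightarrow> nat" where
  "time_of t = card {..t}"

lemma strict_mono_time_of: "strict_mono (time_of :: 'n::{finite,linorder} \<Rightarrow> nat)"
  unfolding strict_mono_def time_of_def by (auto intro!: psubset_card_mono)

lemma bij_betw_time_of:
  "bij_betw (time_of :: 'n::{finite,linorder} \<Rightarrow> nat) UNIV {1..CARD('n)}"
proof -
  have inj: "inj (time_of :: 'n \<Rightarrow> nat)"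
    by (rule strict_mono_imp_inj_on[OF strict_mono_time_of])
  have "range (time_of :: 'n \<Rightarrow> nat) \<subseteq> {1..CARD('n)}"
    by (auto simp: time_of_def Suc_le_eq card_gt_0_iff intro!: card_mono)
  then have "range (time_of :: 'n \<Rightarrow> nat) = {1..CARD('n)}"
    by (rule card_subset_eq[OF finite_atLeastAtMost]) (simp add: card_image[OF inj])
  with inj show ?thesis
    by (simp add: bij_betw_def)
qed

definition upper_half_disk :: "complex set" where
  "upper_half_disk =
     {complex_of_real \<alpha> * exp (\<i> * complex_of_real \<beta>) | \<alpha> \<beta>. \<alpha> \<in> {0..<1} \<and> \<beta> \<in> {0..pi}}"

text \<open>
  Response of \<open>(1 - |k|\<^sup>2) / (q - k)\<close> to the input \<open>u\<close> from zero initial conditions.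
\<close>

definition atom_response :: "real ^ 'n::{finite,linorder} \<Rightarrow> complex \<Rightarrow> complex ^ 'n::{finite,linorder}" where
  "atom_response u k =
     (\<chi> t. complex_of_real (1 - (cmod k)\<^sup>2) *
           (\<Sum>s\<in>{..<t}. k ^ (time_of t - 1 - time_of s) * complex_of_real (u $ s)))"

definition zeta :: "real ^ 'n::{finite,linorder} \<Rightarrow> complex \<Rightarrow> real ^ 2 ^ 'n::{finite,linorder}" where
  "zeta u k = (\<chi> t. vector [2 * Re (atom_response u k $ t), - 2 * Im (atom_response u k $ t)])"

text \<open>
  The discretized problem on a finite set \<open>K\<close> of poles.  The coefficients are indexed by the poles
  themselves; the values of \<open>\<Gamma>\<close> outside \<open>K\<close> are irrelevant.
\<close>

definition residual ::
  "real ^ 'n::{finite,linorder} \<Rightarrow> real ^ 'n::{finite,linorder} \<Rightarrow> complex set \<Rightarrow> (complex \<Rightarrow> real ^ 2) \<Rightarrow> real ^ 'n::{finite,linorder}"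
where
  "residual u y K \<Gamma> = y - (\<Sum>k\<in>K. zeta u k *v \<Gamma> k)"

definition lasso_cost ::
  "real ^ 'n::{finite,linorder} \<Rightarrow> real ^ 'n::{finite,linorder} \<Rightarrow> real \<Rightarrow> complex set \<Rightarrow> (complex \<Rightarrow> real ^ 2) \<Rightarrow> real"
where
  "lasso_cost u y lam K \<Gamma> = (norm (residual u y K \<Gamma>))\<^sup>2 + 2 * lam * (\<Sum>k\<in>K. norm (\<Gamma> k))"

definition lasso_minimizer ::
  "real ^ 'n::{finite,linorder} \<Rightarrow> real ^ 'n::{finite,linorder} \<Rightarrow> real \<Rightarrow> complex set \<Rightarrow> (complex \<Rightarrow> real ^ 2) \<Rightarrow> bool"
where
  "lasso_minimizer u y lam K \<Gamma> \<longleftrightarrow> is_arg_min (lasso_cost u y lam K) (\<lambda>_. True) \<Gamma>"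

definition correlation ::
  "real ^ 'n::{finite,linorder} \<Rightarrow> real ^ 'n::{finite,linorder} \<Rightarrow> complex \<Rightarrow> real"
where
  "correlation u r k = norm (transpose (zeta u k) *v r)"

definition candidate ::
  "real ^ 'n::{finite,linorder} \<Rightarrow> real ^ 'n::{finite,linorder} \<Rightarrow> complex \<Rightarrow> bool"
where
  "candidate u r k \<longleftrightarrow> is_arg_max (correlation u r) (\<lambda>k. k \<in> upper_half_disk) k"

definition greedy_extend ::
  "real ^ 'n::{finite,linorder} \<Rightarrow> real ^ 'n::{finite,linorder} \<Rightarrow> real \<Rightarrow> real \<Rightarrow> complex set \<Rightarrow> (complex \<Rightarrow> real ^ 2)
    \<Rightarrow> complex set \<Rightarrow> (complex \<Rightarrow> real ^ 2) \<Rightarrow> bool"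
where
  "greedy_extend u y lam eps K \<Gamma> K' \<Gamma>' \<longleftrightarrow>
     (\<exists>k. candidate u (residual u y K \<Gamma>) k \<and>
          correlation u (residual u y K \<Gamma>) k \<ge> lam + eps \<and>
          K' = K \<union> {k} \<and> lasso_minimizer u y lam K' \<Gamma>')"

text \<open>
  The initial set, the candidate and the minimizer are chosen nondeterministically, hence the
  relational presentation.  \<open>greedy_at \<dots> l K \<Gamma>\<close>: some run reaches the candidate search with
  counter \<open>l\<close>, current set \<open>K\<close> and computed minimizer \<open>\<Gamma>\<close>.
\<close>

inductive greedy_at ::
  "real ^ 'n::{finite,linorder} \<Rightarrow> real ^ 'n::{finite,linorder} \<Rightarrow> real \<Rightarrow> real \<Rightarrow> nat
    \<Rightarrow> nat \<Rightarrow> complex set \<Rightarrow> (complex \<Rightarrow> real ^ 2) \<Rightarrow> bool"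
  for u y :: "real ^ 'n::{finite,linorder}" and lam eps :: real and lmax :: nat
where
  init: "finite K \<Longrightarrow> K \<subseteq> upper_half_disk \<Longrightarrow> lasso_minimizer u y lam K \<Gamma>
    \<Longrightarrow> greedy_at u y lam eps lmax 0 K \<Gamma>"
| loop: "greedy_at u y lam eps lmax l K \<Gamma> \<Longrightarrow> greedy_extend u y lam eps K \<Gamma> K' \<Gamma>'
    \<Longrightarrow> l + 1 < lmax \<Longrightarrow> greedy_at u y lam eps lmax (l + 1) K' \<Gamma>'"

datatype exit_kind = Break_Exit | Max_Iter_Exit

text \<open>
  \<open>greedy_output \<dots> e l K \<Gamma>\<close>: some run terminates through exit \<open>e\<close> with final counter \<open>l\<close> and
  output \<open>(K, \<Gamma>)\<close>.
\<close>

inductive greedy_output ::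
  "real ^ 'n::{finite,linorder} \<Rightarrow> real ^ 'n::{finite,linorder} \<Rightarrow> real \<Rightarrow> real \<Rightarrow> nat
    \<Rightarrow> exit_kind \<Rightarrow> nat \<Rightarrow> complex set \<Rightarrow> (complex \<Rightarrow> real ^ 2) \<Rightarrow> bool"
  for u y :: "real ^ 'n::{finite,linorder}" and lam eps :: real and lmax :: nat
where
  break_out: "greedy_at u y lam eps lmax l K \<Gamma> \<Longrightarrow> candidate u (residual u y K \<Gamma>) k
    \<Longrightarrow> \<not> correlation u (residual u y K \<Gamma>) k \<ge> lam + eps
    \<Longrightarrow> greedy_output u y lam eps lmax Break_Exit l K \<Gamma>"
| max_iter: "greedy_at u y lam eps lmax l K \<Gamma> \<Longrightarrow> greedy_extend u y lam eps K \<Gamma> K' \<Gamma>'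
    \<Longrightarrow> l + 1 \<ge> lmax \<Longrightarrow> greedy_output u y lam eps lmax Max_Iter_Exit (l + 1) K' \<Gamma>'"

end

theory Submission
  imports Defs
begin

text \<open>
  Perturbing a single active group of a minimizer leaves the smooth-at-zero function
  \<open>d \<mapsto> \<parallel>r - Z d\<parallel>\<^sup>2 + 2 \<lambda> \<parallel>g + d\<parallel>\<close> minimal at \<open>d = 0\<close>, whose stationarity is the equation for
  nonzero groups.  For zero groups, the candidate that fails the test maximizes the correlation with
  the residual over the whole half disk, hence the strict bound.
\<close>

text \<open>Since \<open>g\<close> is nonzero, the norm is differentiable at \<open>g\<close> with
  gradient \<open>sgn g\<close>, so Fermat's rule applies at \<open>d = 0\<close>. The square and
  the penalty both contribute a factor 2, which cancels and leaves \<open>c\<close>.\<close>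

lemma group_lasso_stationary:
  fixes Z :: "real ^ 'm ^ 'n" and r :: "real ^ 'n" and g :: "real ^ 'm"
  assumes "g \<noteq> 0"
    and min: "\<And>d. (norm r)\<^sup>2 + 2 * c * norm g \<le> (norm (r - Z *v d))\<^sup>2 + 2 * c * norm (g + d)"
  shows "transpose Z *v r = c *\<^sub>R (g /\<^sub>R norm g)"
proof -
  \<comment> \<open>The squared norm is written as an inner product so that the product rule yields
    the derivative \<open>F'\<close>.\<close>
  define F where "F d = (r - Z *v d) \<bullet> (r - Z *v d) + 2 * c * norm (g + d)" for d
  define F' where "F' h = - 2 * (r \<bullet> (Z *v h)) + 2 * c * (h \<bullet> sgn g)" for h
  have "((\<lambda>d. g + d) has_derivative (\<lambda>h. h)) (at 0)"
    by (rule derivative_eq_intros refl | simp)+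
  from has_derivative_compose[OF this, of norm "\<lambda>h. h \<bullet> sgn g"]
  have "((\<lambda>d. norm (g + d)) has_derivative (\<lambda>h. h \<bullet> sgn g)) (at 0)"
    using has_derivative_norm[OF \<open>g \<noteq> 0\<close>] by simp
  moreover have "((\<lambda>d. Z *v d) has_derivative (\<lambda>h. Z *v h)) (at 0)"
    by (intro linear_imp_has_derivative matrix_vector_mul_linear)
  ultimately have "(F has_derivative F') (at 0)"
    unfolding F_def F'_def by (auto intro!: derivative_eq_intros simp: inner_commute)
  moreover have "\<forall>\<^sub>F d in at 0. F 0 \<le> F d"
    using min by (simp add: F_def power2_norm_eq_inner)
  ultimately have "F' = (\<lambda>h. 0)"
    by (rule has_derivative_local_min)
  then have "r \<bullet> (Z *v h) = c * (h \<bullet> sgn g)" for h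
    by (simp add: F'_def fun_eq_iff)
  \<comment> \<open>Moving \<open>Z\<close> to the other side of the inner product as its adjoint
    makes both sides functionals of \<open>h\<close>, which determine their representing
    vectors.\<close>
  then have "(transpose Z *v r) \<bullet> h = (c *\<^sub>R (g /\<^sub>R norm g)) \<bullet> h" for h
    by (simp add: dot_lmul_matrix sgn_div_norm inner_commute[of g])
  then show ?thesis
    using vector_eq_rdot by blast
qed

text \<open>Changing only the coefficient at \<open>k\<close> shifts the residual by
  \<open>- zeta u k *v d\<close>, and the penalties of the other groups cancel from the cost
  comparison.\<close>

lemma lasso_minimizer_stationary:
  assumes "finite K" "lasso_minimizer u y lam K \<Gamma>" "k \<in> K" "\<Gamma> k \<noteq> 0"
  shows "transpose (zeta u k) *v residual u y K \<Gamma> = lam *\<^sub>R (\<Gamma> k /\<^sub>R norm (\<Gamma> k))"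
proof (rule group_lasso_stationary[OF \<open>\<Gamma> k \<noteq> 0\<close>])
  fix d
  let ?\<Gamma>' = "\<Gamma>(k := \<Gamma> k + d)"
  have "lasso_cost u y lam K \<Gamma> \<le> lasso_cost u y lam K ?\<Gamma>'"
    using assms(2) by (auto simp: lasso_minimizer_def is_arg_min_linorder)
  moreover have "residual u y K ?\<Gamma>' = residual u y K \<Gamma> - zeta u k *v d"
    using assms by (simp add: residual_def sum.remove[of K k] matrix_vector_right_distrib)
  ultimately show "(norm (residual u y K \<Gamma>))\<^sup>2 + 2 * lam * norm (\<Gamma> k)
      \<le> (norm (residual u y K \<Gamma> - zeta u k *v d))\<^sup>2 + 2 * lam * norm (\<Gamma> k + d)"
    using assms by (simp add: lasso_cost_def sum.remove[of K k] distrib_left)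
qed

text \<open>A candidate is an argmax over the half disk, so adding it stays inside; minimality is
  re-established by each extension.\<close>

lemma greedy_at_invariant:
  assumes "greedy_at u y lam eps lmax l K \<Gamma>"
  shows "finite K \<and> K \<subseteq> upper_half_disk \<and> lasso_minimizer u y lam K \<Gamma>"
  using assms
  by induction (auto simp: greedy_extend_def candidate_def is_arg_max_def)

text \<open>All terms outside the finite set \<open>K\<close> vanish, so the infinite sum collapses
  to a finite one and no convergence question arises.\<close>

lemma infsum_extend_by_zero_eq_residual:
  assumes "finite K" "K \<subseteq> upper_half_disk"
  shows "y - (\<Sum>\<^sub>\<infinity>k\<in>upper_half_disk. zeta u k *v (if k \<in> K then \<Gamma> k else 0)) = residual u y K \<Gamma>"
proof -
  have "(\<Sum>\<^sub>\<infinity>k\<in>upper_half_disk. zeta u k *v (if k \<in> K then \<Gamma> k else 0)) =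
      (\<Sum>\<^sub>\<infinity>k\<in>K. zeta u k *v \<Gamma> k)"
    by (rule infsum_cong_neutral) (use assms in auto)
  then show ?thesis
    using assms by (simp add: residual_def)
qed

theorem proposition1:
  fixes u y :: "real ^ 'n::{finite,linorder}"
    and lam eps :: real
    and lmax l :: nat
    and K :: "complex set"
    and \<Gamma> \<Gamma>hat :: "complex \<Rightarrow> real ^ 2"
    and R :: "real ^ 'n::{finite,linorder}"
  assumes "lam > 0" and "eps > 0" and "lmax > 0"
    and "greedy_output u y lam eps lmax Break_Exit l K \<Gamma>" and "l < lmax"
    and "\<Gamma>hat = (\<lambda>k. if k \<in> K then \<Gamma> k else 0)"
    and "R = y - (\<Sum>\<^sub>\<infinity>k\<in>upper_half_disk. zeta u k *v \<Gamma>hat k)"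
  shows "\<forall>k\<in>upper_half_disk.
           (norm (\<Gamma>hat k) = 0 \<longrightarrow> norm (transpose (zeta u k) *v R) < lam + eps) \<and>
           (norm (\<Gamma>hat k) > 0 \<longrightarrow>
              transpose (zeta u k) *v R - lam *\<^sub>R (\<Gamma>hat k /\<^sub>R norm (\<Gamma>hat k)) = 0)"
proof -
  from assms(4) obtain k' where at: "greedy_at u y lam eps lmax l K \<Gamma>"
    and cand: "candidate u (residual u y K \<Gamma>) k'"
    and stop: "correlation u (residual u y K \<Gamma>) k' < lam + eps"
    by cases auto
  note inv = greedy_at_invariant[OF at]
  have R: "R = residual u y K \<Gamma>"
    unfolding assms(6,7) by (rule infsum_extend_by_zero_eq_residual) (use inv in auto)
  \<comment> \<open>The bound holds at every pole, active or not, because \<open>k'\<close> attains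
    the maximum.\<close>
  have "norm (transpose (zeta u k) *v R) < lam + eps" if "k \<in> upper_half_disk" for k
    using cand stop that unfolding R correlation_def[symmetric]
    by (force simp: candidate_def is_arg_max_linorder)
  \<comment> \<open>A positive norm forces \<open>k \<in> K\<close>, where
    \<open>\<Gamma>hat\<close> agrees with \<open>\<Gamma>\<close>.\<close>
  moreover have "transpose (zeta u k) *v R - lam *\<^sub>R (\<Gamma>hat k /\<^sub>R norm (\<Gamma>hat k)) = 0"
    if "norm (\<Gamma>hat k) > 0" for k
    using lasso_minimizer_stationary[of K u y lam \<Gamma> k] inv that
    by (auto simp: R assms(6) split: if_splits)
  ultimately show ?thesis
    by blast
qed

end
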